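(* Let $R$ be a commutative ring with identity. Then the following statements are equivalent: (1) $\mathbb{AG}(R)$ is a finite graph. (2) $R$ has only finitely many ideals. (3) Every vertex of $\mathbb{AG}(R)$ has finite degree. Moreover, for $n\geq 1$, $\mathbb{AG}(R)$ has $n$ vertices if and only if $R$ has only $n$ (i.e. exactly $n$) nonzero proper ideals.
   Context: An ideal $I$ of a commutative ring $R$ is called an annihilating-ideal if there exists a nonzero ideal $J$ of $R$ with $IJ=(0)$. $\mathbb{A}(R)$ denotes the set of all annihilating-ideals of $R$, and $\mathbb{A}(R)^*=\mathbb{A}(R)\setminus\{(0)\}$. The annihilating-ideal graph $\mathbb{AG}(R)$ is the undirected graph with vertex set $\mathbb{A}(R)^*$ in which two distinct vertices $I,J$ are adjacent if and only if $IJ=(0)$. A finite graph is one with finitely many vertices; the degree of a vertex is the number of vertices adjacent to it.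
   Formalization: The equivalence of (1)–(3) is stated only for rings R that are fields or not integral domains: for R = Z the graph has no vertices, so (1) and (3) hold while (2) fails, and likewise for every non-field domain; the "moreover" part is unrestricted. *)

theory Defs
  imports "HOL-Algebra.Ideal_Product"
begin

definition annihilating_ideals :: "('a, 'b) ring_scheme \<Rightarrow> 'a set set" where
  "annihilating_ideals R =
     {I. ideal I R \<and> (\<exists>J. ideal J R \<and> J \<noteq> {\<zero>\<^bsub>R\<^esub>} \<and> I \<cdot>\<^bsub>R\<^esub> J = {\<zero>\<^bsub>R\<^esub>})}"

text \<open>An undirected graph has edges that are two-element sets of vertices.\<close>

record 'v ugraph =
  vertices :: "'v set"
  edges :: "'v set set"

definition finite_ugraph :: "'v ugraph \<Rightarrow> bool" where
  "finite_ugraph G \<longleftrightarrow> finite (vertices G)"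

definition neighbours :: "'v ugraph \<Rightarrow> 'v \<Rightarrow> 'v set" where
  "neighbours G v = {w \<in> vertices G. {v, w} \<in> edges G}"

text \<open>The degree is the cardinality of the neighbourhood; its finiteness is stated on the
  neighbourhood itself, because \<^const>\<open>card\<close> is 0 on infinite sets.\<close>

definition finite_degree :: "'v ugraph \<Rightarrow> 'v \<Rightarrow> bool" where
  "finite_degree G v \<longleftrightarrow> finite (neighbours G v)"

definition annihilating_ideal_graph :: "('a, 'b) ring_scheme \<Rightarrow> 'a set ugraph" where
  "annihilating_ideal_graph R =
     \<lparr> vertices = annihilating_ideals R - {{\<zero>\<^bsub>R\<^esub>}},
       edges = {{I, J} | I J.
         I \<in> annihilating_ideals R - {{\<zero>\<^bsub>R\<^esub>}} \<and>
         J \<in> annihilating_ideals R - {{\<zero>\<^bsub>R\<^esub>}} \<and>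
         I \<noteq> J \<and> I \<cdot>\<^bsub>R\<^esub> J = {\<zero>\<^bsub>R\<^esub>}} \<rparr>"

definition nonzero_proper_ideals :: "('a, 'b) ring_scheme \<Rightarrow> 'a set set" where
  "nonzero_proper_ideals R = {I. ideal I R \<and> I \<noteq> {\<zero>\<^bsub>R\<^esub>} \<and> I \<noteq> carrier R}"

end

theory Submission
  imports Defs
begin

text \<open>Suppose \<open>x z = 0\<close> with \<open>x\<close>, \<open>z\<close> nonzero and all degrees finite. Then the annihilators of
  \<open>x\<close> and of \<open>z\<close> contain only finitely many ideals, and counting the ideals below
  \<open>aR \<inter> Ann x\<close> and below \<open>axR\<close> yields a rank that strictly decreases along chains of principal
  ideals. The descending chain condition on principal ideals forces every proper ideal \<open>I\<close> to
  be killed by some nonzero \<open>y\<close>. Either \<open>y\<close> lies in \<open>Ann x\<close> or \<open>yx\<close> is a nonzero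
  element of \<open>Ann z\<close>, so \<open>I\<close> is killed by one of finitely many nonzero ideals, each of which
  has finite degree.\<close>

context cring
begin

section \<open>Ideal products, annihilators and principal ideals\<close>

lemma ideal_prod_eq_zero_iff:
  assumes "ideal I R" "ideal J R"
  shows "I \<cdot> J = {\<zero>} \<longleftrightarrow> (\<forall>i\<in>I. \<forall>j\<in>J. i \<otimes> j = \<zero>)"
proof
  assume "I \<cdot> J = {\<zero>}"
  then show "\<forall>i\<in>I. \<forall>j\<in>J. i \<otimes> j = \<zero>"
    using ideal_prod.prod[of _ I _ J R] by blast
next
  assume ann: "\<forall>i\<in>I. \<forall>j\<in>J. i \<otimes> j = \<zero>"
  have "s = \<zero>" if "s \<in> I \<cdot> J" for s
    using that by induction (use ann in auto)
  moreover have "\<zero> \<in> I \<cdot> J"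
    using ideal_prod.prod[of \<zero> I \<zero> J R] assms
    by (simp add: additive_subgroup.zero_closed ideal.axioms(1))
  ultimately show "I \<cdot> J = {\<zero>}" by blast
qed

lemma ideal_annihilator:
  assumes "x \<in> carrier R"
  shows "ideal {r \<in> carrier R. r \<otimes> x = \<zero>} R"
proof (rule idealI[OF ring_axioms])
  show "subgroup {r \<in> carrier R. r \<otimes> x = \<zero>} (add_monoid R)"
    using assms by (auto intro!: add.subgroupI simp: l_distr l_minus)
qed (use assms in \<open>auto simp: m_assoc\<close>, metis m_lcomm r_null)

lemma cgenideal_iff: "b \<in> PIdl a \<longleftrightarrow> (\<exists>r\<in>carrier R. b = r \<otimes> a)"
  unfolding cgenideal_def by auto

lemma ideal_prod_cgenideal_eq_zero_iff:
  assumes I: "ideal I R" and y: "y \<in> carrier R"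
  shows "I \<cdot> (PIdl y) = {\<zero>} \<longleftrightarrow> (\<forall>i\<in>I. i \<otimes> y = \<zero>)"
proof -
  have "i \<otimes> (r \<otimes> y) = r \<otimes> (i \<otimes> y)" if "i \<in> I" "r \<in> carrier R" for i r
    using that y m_lcomm[of i r y] ideal.Icarr[OF I, of i] by simp
  then have "\<forall>j\<in>PIdl y. i \<otimes> j = \<zero>" if "i \<in> I" "i \<otimes> y = \<zero>" for i
    using that by (auto simp: cgenideal_iff)
  then show ?thesis
    unfolding ideal_prod_eq_zero_iff[OF I cgenideal_ideal[OF y]]
    using cgenideal_self[OF y] by blast
qed

lemma ideal_neq_zero_iff:
  assumes "ideal I R"
  shows "I \<noteq> {\<zero>} \<longleftrightarrow> (\<exists>x\<in>I. x \<noteq> \<zero>)"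
  using additive_subgroup.zero_closed[OF ideal.axioms(1)[OF assms]] by auto

section \<open>Descending chains of principal ideals\<close>

text \<open>An element of least rank works. This is the descending chain condition on principal
  ideals in its minimal-element form, phrased through generators because later choices are made
  among elements of the ring.\<close>

lemma cgenideal_minimal_of_rank:
  fixes rank :: "'a \<Rightarrow> nat"
  assumes rank: "\<And>a b. \<lbrakk>a \<in> carrier R; b \<in> carrier R; PIdl a \<subset> PIdl b\<rbrakk> \<Longrightarrow> rank a < rank b"
    and S: "S \<subseteq> carrier R" "S \<noteq> {}"
  shows "\<exists>a\<in>S. \<forall>b\<in>S. b \<in> PIdl a \<longrightarrow> a \<in> PIdl b"
proof -
  obtain a where a: "a \<in> S" "\<And>b. b \<in> S \<Longrightarrow> rank a \<le> rank b"
  proof -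
    obtain s where "s \<in> S" using S(2) by blast
    then show thesis
      using that[of "arg_min rank (\<lambda>x. x \<in> S)"] arg_min_natI[of "\<lambda>x. x \<in> S" s rank]
        arg_min_nat_le[of "\<lambda>x. x \<in> S" _ rank] by simp
  qed
  have "a \<in> PIdl b" if "b \<in> S" "b \<in> PIdl a" for b
  proof (rule ccontr)
    assume "a \<notin> PIdl b"
    moreover have "a \<in> PIdl a" "PIdl b \<subseteq> PIdl a"
      using that a(1) S cgenideal_self cgenideal_ideal cgenideal_minimal by blast+
    ultimately have "rank b < rank a"
      using rank[of b a] that a(1) S by blast
    then show False using a(2)[OF that(1)] by simp
  qed
  then show ?thesis using a(1) by blast
qed

text \<open>The chain of ideals generated by the powers of \<open>a\<close> stabilises, so some
  power \<open>p\<close> satisfies \<open>p = d p^2\<close>. Then \<open>d p\<close> is idempotent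
  and fixes \<open>p\<close>.\<close>

lemma idempotent_multiple_of_power:
  assumes dcc: "\<And>S. \<lbrakk>S \<subseteq> carrier R; S \<noteq> {}\<rbrakk> \<Longrightarrow> \<exists>a\<in>S. \<forall>b\<in>S. b \<in> PIdl a \<longrightarrow> a \<in> PIdl b"
    and a: "a \<in> carrier R"
  obtains c n where "c \<in> carrier R"
    "(c \<otimes> a) \<otimes> (c \<otimes> a) = c \<otimes> a" "a [^] (n::nat) \<otimes> (c \<otimes> a) = a [^] n"
proof -
  let ?S = "range (\<lambda>n::nat. a [^] Suc n)"
  have "?S \<subseteq> carrier R" using a by auto
  then obtain n where n: "\<And>b. \<lbrakk>b \<in> ?S; b \<in> PIdl (a [^] Suc n)\<rbrakk> \<Longrightarrow> a [^] Suc n \<in> PIdl b"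
    using dcc[of ?S] by blast
  \<comment> \<open>The exponent is kept as a successor so that the square visibly lies in
    \<open>?S\<close>.\<close>
  have sq: "a [^] Suc n \<otimes> a [^] Suc n = a [^] Suc (n + Suc n)"
    using a nat_pow_mult[of a "Suc n" "Suc n"] by simp
  have "a [^] Suc (n + Suc n) \<in> PIdl (a [^] Suc n)"
    unfolding sq[symmetric] using a by (auto simp: cgenideal_def)
  then have "a [^] Suc n \<in> PIdl (a [^] Suc n \<otimes> a [^] Suc n)"
    unfolding sq by (rule n[OF rangeI])
  then obtain d where d: "d \<in> carrier R" "a [^] Suc n = d \<otimes> (a [^] Suc n \<otimes> a [^] Suc n)"
    by (auto simp: cgenideal_iff)
  define p where "p = a [^] Suc n"
  have p: "p \<in> carrier R" "d \<otimes> (p \<otimes> p) = p" using a d by (auto simp: p_def)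
  have pn: "p = a [^] n \<otimes> a" by (simp add: p_def)
  define c where "c = d \<otimes> a [^] n"
  have ca: "c \<otimes> a = d \<otimes> p" using a d(1) by (simp add: c_def pn m_assoc)
  show thesis
  proof (rule that[of c "Suc n"])
    show "c \<in> carrier R" using a d(1) by (simp add: c_def)
    have "(d \<otimes> p) \<otimes> (d \<otimes> p) = d \<otimes> (d \<otimes> (p \<otimes> p))" using p(1) d(1) by (simp add: m_ac)
    then show "(c \<otimes> a) \<otimes> (c \<otimes> a) = c \<otimes> a" by (simp add: ca p(2))
    have "p \<otimes> (d \<otimes> p) = d \<otimes> (p \<otimes> p)" using p(1) d(1) by (simp add: m_ac)
    then show "a [^] Suc n \<otimes> (c \<otimes> a) = a [^] Suc n"
      by (simp only: ca p(2) p_def[symmetric])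
  qed
qed

text \<open>An idempotent \<open>u\<close> with \<open>1 - u\<close> in \<open>I\<close> splits the
  ring into \<open>uR\<close> and \<open>(1 - u)R\<close>, the latter inside \<open>I\<close>. For
  minimal \<open>u\<close>, the part of \<open>I\<close> in \<open>uR\<close> consists of
  nilpotents. A generator \<open>y\<close> of a minimal nonzero principal ideal inside
  \<open>uR\<close> is then killed by \<open>I\<close>, since otherwise a nilpotent would fix
  it.\<close>

lemma proper_ideal_annihilated:
  assumes dcc: "\<And>S. \<lbrakk>S \<subseteq> carrier R; S \<noteq> {}\<rbrakk> \<Longrightarrow> \<exists>a\<in>S. \<forall>b\<in>S. b \<in> PIdl a \<longrightarrow> a \<in> PIdl b"
    and I: "ideal I R" "I \<noteq> carrier R"
  shows "\<exists>y\<in>carrier R. y \<noteq> \<zero> \<and> (\<forall>i\<in>I. i \<otimes> y = \<zero>)"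
proof -
  interpret I: ideal I R by (rule I)
  let ?S = "{u \<in> carrier R. u \<otimes> u = u \<and> \<one> \<ominus> u \<in> I}"
  have "\<one> \<in> ?S" by (simp add: r_neg a_minus_def)
  then obtain u where u: "u \<in> carrier R" "u \<otimes> u = u" "\<one> \<ominus> u \<in> I"
    and u_min: "\<And>v. \<lbrakk>v \<in> ?S; v \<in> PIdl u\<rbrakk> \<Longrightarrow> u \<in> PIdl v"
    using dcc[of ?S] by blast
  \<comment> \<open>A nonzero idempotent multiple \<open>f\<close> of \<open>u a\<close> would make \<open>u - f\<close> strictly
    below the minimal \<open>u\<close>, so \<open>f = 0\<close>.\<close>
  have nil: "\<exists>n::nat. (u \<otimes> a) [^] n = \<zero>" if "a \<in> I" for a
  proof -
    have a: "a \<in> carrier R" using that by auto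
    obtain c n where c: "c \<in> carrier R"
      and idem: "(c \<otimes> (u \<otimes> a)) \<otimes> (c \<otimes> (u \<otimes> a)) = c \<otimes> (u \<otimes> a)"
      and pow: "(u \<otimes> a) [^] (n::nat) \<otimes> (c \<otimes> (u \<otimes> a)) = (u \<otimes> a) [^] n"
      using idempotent_multiple_of_power[OF dcc, of "u \<otimes> a"] u a by blast
    define f where "f = c \<otimes> (u \<otimes> a)"
    have f: "f \<in> carrier R" "f \<in> I" "f \<otimes> f = f"
      using a c u that idem by (auto simp: f_def I.I_l_closed)
    have "u \<otimes> f = c \<otimes> ((u \<otimes> u) \<otimes> a)" using a c u(1) by (simp add: f_def m_ac)
    then have uf: "u \<otimes> f = f" by (simp add: u(2) f_def)
    let ?v = "u \<ominus> f"
    have "?v \<otimes> ?v = u \<otimes> u \<ominus> u \<otimes> f \<ominus> u \<otimes> f \<oplus> f \<otimes> f" using u(1) f(1) by algebra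
    also have "\<dots> = ?v" using u(1) f(1) unfolding uf u(2) f(3) by algebra
    finally have "?v \<otimes> ?v = ?v" .
    moreover have "\<one> \<ominus> ?v = (\<one> \<ominus> u) \<oplus> f" using u(1) f(1) by algebra
    ultimately have "?v \<in> ?S" using u f by simp
    moreover have "?v = (\<one> \<ominus> f) \<otimes> u"
    proof -
      have "(\<one> \<ominus> f) \<otimes> u = u \<ominus> u \<otimes> f" using u(1) f(1) by algebra
      then show ?thesis by (simp add: uf)
    qed
    then have "?v \<in> PIdl u" using f(1) unfolding cgenideal_iff by blast
    ultimately obtain r where r: "r \<in> carrier R" "u = r \<otimes> ?v"
      using u_min unfolding cgenideal_iff by blast
    have "f = u \<otimes> f" by (simp add: uf)
    \<comment> \<open>The product of \<open>?v\<close> and \<open>f\<close> vanishes, so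
      \<open>u\<close> being a multiple of \<open>?v\<close> forces
      \<open>f = u f = 0\<close>.\<close>
    also have "\<dots> = (r \<otimes> ?v) \<otimes> f" using r(2) by simp
    also have "\<dots> = r \<otimes> (u \<otimes> f \<ominus> f \<otimes> f)" using r(1) u(1) f(1) by algebra
    also have "\<dots> = \<zero>" using r(1) f(1) by (simp add: uf f(3) a_minus_def r_neg)
    finally have "(u \<otimes> a) [^] n = (u \<otimes> a) [^] n \<otimes> \<zero>"
      using pow f_def by simp
    then show ?thesis using u(1) a by (metis m_closed nat_pow_closed r_null)
  qed
  have "u \<noteq> \<zero>"
  proof
    assume "u = \<zero>"
    then have "\<one> \<in> I" using u(3) by (simp add: a_minus_def)
    then show False using I(2) I.one_imp_carrier by blast
  qed
  \<comment> \<open>As \<open>u\<close> is idempotent, these are exactly the nonzero elements of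
    \<open>uR\<close>.\<close>
  let ?T = "{y \<in> carrier R. y \<noteq> \<zero> \<and> y \<otimes> u = y}"
  have "u \<in> ?T" using u \<open>u \<noteq> \<zero>\<close> by simp
  then obtain y where y: "y \<in> carrier R" "y \<noteq> \<zero>" "y \<otimes> u = y"
    and y_min: "\<And>z. \<lbrakk>z \<in> ?T; z \<in> PIdl y\<rbrakk> \<Longrightarrow> y \<in> PIdl z"
    using dcc[of ?T] by blast
  have "i \<otimes> y = \<zero>" if "i \<in> I" for i
  proof (rule ccontr)
    assume nz: "i \<otimes> y \<noteq> \<zero>"
    have i: "i \<in> carrier R" using that by auto
    have "i \<otimes> y \<in> ?T" using nz i y u by (simp add: m_assoc)
    moreover have "i \<otimes> y \<in> PIdl y" using i unfolding cgenideal_iff by blast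
    ultimately obtain r where r: "r \<in> carrier R" "y = r \<otimes> (i \<otimes> y)"
      using y_min unfolding cgenideal_iff by blast
    \<comment> \<open>The factor \<open>u\<close> makes \<open>nil\<close> applicable to
      \<open>b\<close>, and since \<open>y u = y\<close> it does not disturb \<open>y b = y\<close>.
      So \<open>y\<close> equals \<open>y b^n\<close> for every \<open>n\<close>, although some
      power of \<open>b\<close> is zero.\<close>
    define b where "b = u \<otimes> (r \<otimes> i)"
    have b: "b \<in> carrier R" using u(1) r(1) i by (simp add: b_def)
    have "y \<otimes> b = r \<otimes> (i \<otimes> (y \<otimes> u))" using u(1) r(1) i y(1) by (simp add: b_def m_ac)
    also have "\<dots> = y" using r(2) y(3) by simp
    finally have yb: "y \<otimes> b = y" .
    have "y \<otimes> b [^] n = y" for n :: nat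
    proof (induction n)
      case (Suc n)
      have "y \<otimes> b [^] Suc n = (y \<otimes> b [^] n) \<otimes> b" using y(1) b by (simp add: m_assoc)
      then show ?case by (simp add: Suc yb)
    qed (use y in simp)
    moreover obtain n :: nat where "b [^] n = \<zero>"
      using nil[of "r \<otimes> i"] I.I_l_closed[OF \<open>i \<in> I\<close> r(1)] unfolding b_def by blast
    ultimately have "y = \<zero>" using y(1) by (metis r_null)
    then show False using y(2) by simp
  qed
  then show ?thesis using y by blast
qed

text \<open>When there are finitely many ideals, the number of ideals below \<open>PIdl a\<close>
  serves as the rank.\<close>

lemma proper_ideal_annihilated_of_finite:
  assumes fin: "finite {I. ideal I R}" and I: "ideal I R" "I \<noteq> carrier R"
  shows "\<exists>y\<in>carrier R. y \<noteq> \<zero> \<and> (\<forall>i\<in>I. i \<otimes> y = \<zero>)"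
proof (rule proper_ideal_annihilated[OF cgenideal_minimal_of_rank I])
  fix a b assume ab: "a \<in> carrier R" "b \<in> carrier R" "PIdl a \<subset> PIdl b"
  show "card {J. ideal J R \<and> J \<subseteq> PIdl a} < card {J. ideal J R \<and> J \<subseteq> PIdl b}"
    using ab cgenideal_ideal[OF ab(2)]
    by (intro psubset_card_mono finite_subset[OF _ fin]) auto
qed

section \<open>Vertices of the annihilating-ideal graph\<close>

text \<open>Any nonzero element of a nonzero ideal \<open>J\<close> that kills \<open>I\<close> can
  serve as \<open>y\<close>; conversely \<open>PIdl y\<close> is such a \<open>J\<close>.\<close>

lemma annihilating_ideals_iff:
  "I \<in> annihilating_ideals R \<longleftrightarrow>
    ideal I R \<and> (\<exists>y\<in>carrier R. y \<noteq> \<zero> \<and> (\<forall>i\<in>I. i \<otimes> y = \<zero>))"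
proof (intro iffI conjI)
  assume "I \<in> annihilating_ideals R"
  then obtain J where I: "ideal I R" and J: "ideal J R" "J \<noteq> {\<zero>}" "I \<cdot> J = {\<zero>}"
    by (auto simp: annihilating_ideals_def)
  obtain y where y: "y \<in> J" "y \<noteq> \<zero>" using J(2) ideal_neq_zero_iff[OF J(1)] by blast
  have "\<forall>i\<in>I. i \<otimes> y = \<zero>" using J(3) y(1) ideal_prod_eq_zero_iff[OF I J(1)] by blast
  then show "\<exists>y\<in>carrier R. y \<noteq> \<zero> \<and> (\<forall>i\<in>I. i \<otimes> y = \<zero>)"
    using y ideal.Icarr[OF J(1)] by blast
  show "ideal I R" by (rule I)
next
  assume I: "ideal I R \<and> (\<exists>y\<in>carrier R. y \<noteq> \<zero> \<and> (\<forall>i\<in>I. i \<otimes> y = \<zero>))"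
  then obtain y where y: "y \<in> carrier R" "y \<noteq> \<zero>" "\<forall>i\<in>I. i \<otimes> y = \<zero>" by blast
  have "I \<cdot> (PIdl y) = {\<zero>}" using I y ideal_prod_cgenideal_eq_zero_iff by blast
  moreover have "PIdl y \<noteq> {\<zero>}" using y cgenideal_self by blast
  ultimately show "I \<in> annihilating_ideals R"
    using I cgenideal_ideal[OF y(1)] unfolding annihilating_ideals_def by blast
qed

lemma vertices_annihilating_ideal_graph:
  "vertices (annihilating_ideal_graph R) = annihilating_ideals R - {{\<zero>}}"
  by (simp add: annihilating_ideal_graph_def)

text \<open>The whole ring is not annihilating, because \<open>1\<close> is killed only by
  zero.\<close>

lemma vertices_subset_nonzero_proper_ideals:
  "vertices (annihilating_ideal_graph R) \<subseteq> nonzero_proper_ideals R"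
proof -
  have "carrier R \<notin> annihilating_ideals R"
    unfolding annihilating_ideals_iff by (metis l_one one_closed)
  then show ?thesis
    unfolding vertices_annihilating_ideal_graph nonzero_proper_ideals_def
    using annihilating_ideals_iff by blast
qed

lemma vertices_eq_nonzero_proper_ideals:
  assumes "finite {I. ideal I R}"
  shows "vertices (annihilating_ideal_graph R) = nonzero_proper_ideals R"
proof
  show "nonzero_proper_ideals R \<subseteq> vertices (annihilating_ideal_graph R)"
    unfolding vertices_annihilating_ideal_graph nonzero_proper_ideals_def
    using proper_ideal_annihilated_of_finite[OF assms] annihilating_ideals_iff by blast
qed (rule vertices_subset_nonzero_proper_ideals)

lemma finite_nonzero_proper_ideals_iff:
  "finite (nonzero_proper_ideals R) \<longleftrightarrow> finite {I. ideal I R}"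
proof
  assume "finite (nonzero_proper_ideals R)"
  then have "finite (nonzero_proper_ideals R \<union> {{\<zero>}, carrier R})" by simp
  then show "finite {I. ideal I R}"
    by (rule finite_subset[rotated]) (auto simp: nonzero_proper_ideals_def)
next
  assume "finite {I. ideal I R}"
  then show "finite (nonzero_proper_ideals R)"
    by (rule finite_subset[rotated]) (auto simp: nonzero_proper_ideals_def)
qed

section \<open>From finite degrees to finitely many ideals\<close>

text \<open>An ideal killing \<open>J\<close> is zero, \<open>J\<close> itself (the graph has no
  loops), or a neighbour of \<open>J\<close>. The degree hypothesis speaks about \<open>J\<close>
  only once \<open>J\<close> is a vertex, which needs a nonzero ideal killing it; hence the case
  split.\<close>

lemma finite_annihilated_ideals:
  assumes deg: "\<forall>I \<in> vertices (annihilating_ideal_graph R).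
      finite_degree (annihilating_ideal_graph R) I"
    and J: "ideal J R" "J \<noteq> {\<zero>}"
  shows "finite {I. ideal I R \<and> I \<cdot> J = {\<zero>}}" (is "finite ?A")
proof (cases "?A \<subseteq> {{\<zero>}}")
  case True
  then show ?thesis using finite_subset by blast
next
  case False
  then obtain I where I: "ideal I R" "I \<cdot> J = {\<zero>}" "I \<noteq> {\<zero>}" by blast
  have JI: "J \<cdot> I = {\<zero>}" using I J ideal_prod_commute by blast
  have V: "K \<in> vertices (annihilating_ideal_graph R)" if "K \<in> ?A" "K \<noteq> {\<zero>}" for K
    using that J by (auto simp: vertices_annihilating_ideal_graph annihilating_ideals_def)
  have VJ: "J \<in> vertices (annihilating_ideal_graph R)"
    using I J JI by (auto simp: vertices_annihilating_ideal_graph annihilating_ideals_def)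
  have "K \<in> neighbours (annihilating_ideal_graph R) J"
    if "K \<in> ?A" "K \<noteq> {\<zero>}" "K \<noteq> J" for K
  proof -
    have "{J, K} = {K, J}" by blast
    then show ?thesis
      using V[OF that(1,2)] VJ that
      unfolding neighbours_def annihilating_ideal_graph_def by auto
  qed
  then have "?A \<subseteq> neighbours (annihilating_ideal_graph R) J \<union> {{\<zero>}, J}" by blast
  moreover have "finite (neighbours (annihilating_ideal_graph R) J)"
    using deg VJ by (auto simp: finite_degree_def)
  ultimately show ?thesis using finite_subset by blast
qed

text \<open>The ideals inside the annihilator of \<open>x\<close> are ideals that kill
  \<open>PIdl x\<close>.\<close>

lemma finite_ideals_in_annihilator:
  assumes deg: "\<forall>I \<in> vertices (annihilating_ideal_graph R).
      finite_degree (annihilating_ideal_graph R) I"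
    and x: "x \<in> carrier R" "x \<noteq> \<zero>"
  shows "finite {I. ideal I R \<and> I \<subseteq> {r \<in> carrier R. r \<otimes> x = \<zero>}}"
proof -
  have "ideal (PIdl x) R" "PIdl x \<noteq> {\<zero>}" using x cgenideal_ideal cgenideal_self by blast+
  note fin = finite_annihilated_ideals[OF deg this]
  have "I \<cdot> (PIdl x) = {\<zero>}"
    if "ideal I R" "I \<subseteq> {r \<in> carrier R. r \<otimes> x = \<zero>}" for I
    using that x ideal_prod_cgenideal_eq_zero_iff by blast
  then have "{I. ideal I R \<and> I \<subseteq> {r \<in> carrier R. r \<otimes> x = \<zero>}}
      \<subseteq> {I. ideal I R \<and> I \<cdot> (PIdl x) = {\<zero>}}" by blast
  then show ?thesis using fin by (rule finite_subset)
qed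

text \<open>Multiplication by \<open>x\<close> maps \<open>PIdl a\<close> onto
  \<open>PIdl (a x)\<close> with kernel the intersection of \<open>PIdl a\<close> and
  \<open>?K\<close>. Kernel and image lie in \<open>?K\<close> and \<open>?L\<close>, which contain
  finitely many ideals each, so counting ideals in both measures \<open>PIdl a\<close> even if it
  has infinitely many subideals itself.\<close>

lemma finite_ideals_of_finite_degrees:
  assumes deg: "\<forall>I \<in> vertices (annihilating_ideal_graph R).
      finite_degree (annihilating_ideal_graph R) I"
    and x: "x \<in> carrier R" "x \<noteq> \<zero>" and z: "z \<in> carrier R" "z \<noteq> \<zero>"
    and xz: "x \<otimes> z = \<zero>"
  shows "finite {I. ideal I R}"
proof -
  let ?K = "{r \<in> carrier R. r \<otimes> x = \<zero>}" and ?L = "{r \<in> carrier R. r \<otimes> z = \<zero>}"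
  let ?below = "\<lambda>A. {J. ideal J R \<and> J \<subseteq> A}"
  have finK: "finite (?below ?K)" and finL: "finite (?below ?L)"
    using finite_ideals_in_annihilator[OF deg] x z by auto
  \<comment> \<open>An ideal belongs to the family of ideals below it, so equal families give back
    the inclusion.\<close>
  have below_eqD: "J \<subseteq> A" if "?below J = ?below A" "ideal J R" for J A
  proof -
    have "J \<in> ?below J" using that(2) by simp
    then show ?thesis unfolding that(1) by simp
  qed
  have mult_x_L: "PIdl (a \<otimes> x) \<subseteq> ?L" if "a \<in> carrier R" for a
    using that x z xz by (auto simp: cgenideal_iff m_assoc)
  let ?rank = "\<lambda>a. card (?below (PIdl a \<inter> ?K)) + card (?below (PIdl (a \<otimes> x)))"
  have "?rank a < ?rank b" if a: "a \<in> carrier R" and b: "b \<in> carrier R" and ab: "PIdl a \<subset> PIdl b" for a b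
  proof -
    have fK: "finite (?below (PIdl b \<inter> ?K))"
      using finK by (rule finite_subset[rotated]) blast
    have fL: "finite (?below (PIdl (b \<otimes> x)))"
      using finL by (rule finite_subset[rotated]) (use mult_x_L[OF b] in blast)
    obtain s where s: "s \<in> carrier R" "a = s \<otimes> b"
      using ab cgenideal_self[OF a] cgenideal_iff[of a b] by blast
    have sub: "PIdl (a \<otimes> x) \<subseteq> PIdl (b \<otimes> x)"
    proof -
      have "a \<otimes> x = s \<otimes> (b \<otimes> x)" using s b x by (simp add: m_assoc)
      then have "a \<otimes> x \<in> PIdl (b \<otimes> x)" using s(1) unfolding cgenideal_iff by blast
      then show ?thesis using b x cgenideal_ideal cgenideal_minimal by simp
    qed
    have mono: "?below (PIdl a \<inter> ?K) \<subseteq> ?below (PIdl b \<inter> ?K)"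
      "?below (PIdl (a \<otimes> x)) \<subseteq> ?below (PIdl (b \<otimes> x))" using ab sub by auto
    \<comment> \<open>If kernel and image both agree, then \<open>b x = r a x\<close> for some
      \<open>r\<close>, so \<open>b - r a\<close> lies in the kernel for \<open>b\<close>, hence in
      \<open>PIdl a\<close>. This puts \<open>b\<close> itself in \<open>PIdl a\<close>, against
      strictness.\<close>
    have "\<not> (?below (PIdl a \<inter> ?K) = ?below (PIdl b \<inter> ?K) \<and>
        ?below (PIdl (a \<otimes> x)) = ?below (PIdl (b \<otimes> x)))"
    proof
      assume eq: "?below (PIdl a \<inter> ?K) = ?below (PIdl b \<inter> ?K) \<and>
        ?below (PIdl (a \<otimes> x)) = ?below (PIdl (b \<otimes> x))"
      have "ideal (PIdl b \<inter> ?K) R"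
        using i_intersect[OF cgenideal_ideal[OF b] ideal_annihilator[OF x(1)]] .
      then have K: "PIdl b \<inter> ?K \<subseteq> PIdl a" using eq below_eqD[of "PIdl b \<inter> ?K" "PIdl a \<inter> ?K"] by simp
      have "ideal (PIdl (b \<otimes> x)) R" using b x cgenideal_ideal by simp
      then have "PIdl (b \<otimes> x) \<subseteq> PIdl (a \<otimes> x)"
        using eq below_eqD[of "PIdl (b \<otimes> x)" "PIdl (a \<otimes> x)"] by simp
      then have "b \<otimes> x \<in> PIdl (a \<otimes> x)" using b x cgenideal_self by blast
      then obtain r where r: "r \<in> carrier R" "b \<otimes> x = r \<otimes> (a \<otimes> x)"
        using cgenideal_iff by blast
      have "(b \<ominus> r \<otimes> a) \<otimes> x = b \<otimes> x \<ominus> r \<otimes> (a \<otimes> x)" using a b r(1) x(1) by algebra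
      also have "\<dots> = \<zero>" unfolding r(2) using a r(1) x(1) by (simp add: a_minus_def r_neg)
      finally have "b \<ominus> r \<otimes> a \<in> ?K" using a b r(1) by simp
      moreover have "b \<ominus> r \<otimes> a = (\<one> \<ominus> r \<otimes> s) \<otimes> b"
        unfolding s(2) using b r(1) s(1) by algebra
      then have "b \<ominus> r \<otimes> a \<in> PIdl b" using r(1) s(1) unfolding cgenideal_iff by blast
      ultimately have "b \<ominus> r \<otimes> a \<in> PIdl a" using K by blast
      then obtain t where t: "t \<in> carrier R" "b \<ominus> r \<otimes> a = t \<otimes> a"
        using cgenideal_iff by blast
      have "b = (b \<ominus> r \<otimes> a) \<oplus> r \<otimes> a" using a b r(1) by algebra
      also have "\<dots> = (t \<oplus> r) \<otimes> a" unfolding t(2) using a r(1) t(1) by algebra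
      finally have "b \<in> PIdl a" using t(1) r(1) unfolding cgenideal_iff by blast
      then have "PIdl b \<subseteq> PIdl a" using a cgenideal_ideal cgenideal_minimal by blast
      then show False using ab by blast
    qed
    then consider "?below (PIdl a \<inter> ?K) \<subset> ?below (PIdl b \<inter> ?K)"
      | "?below (PIdl (a \<otimes> x)) \<subset> ?below (PIdl (b \<otimes> x))"
      using mono by blast
    then show ?thesis
      using psubset_card_mono[OF fK] psubset_card_mono[OF fL]
        card_mono[OF fK mono(1)] card_mono[OF fL mono(2)]
      by cases (simp_all only: add_less_le_mono add_le_less_mono)
  qed
  note dcc = cgenideal_minimal_of_rank[of ?rank, OF this]
  \<comment> \<open>A finite supply of nonzero ideals, one of which kills any given proper ideal.
    The whole ring is killed by none of them and is adjoined separately.\<close>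
  let ?P = "(?below ?K \<union> ?below ?L) - {{\<zero>}}"
  have "I \<in> insert (carrier R) (\<Union>J\<in>?P. {I. ideal I R \<and> I \<cdot> J = {\<zero>}})" if I: "ideal I R" for I
  proof (cases "I = carrier R")
    case False
    then obtain y where y: "y \<in> carrier R" "y \<noteq> \<zero>" "\<forall>i\<in>I. i \<otimes> y = \<zero>"
      using proper_ideal_annihilated[OF dcc I] by blast
    obtain w where w: "w \<in> carrier R" "w \<noteq> \<zero>" "\<forall>i\<in>I. i \<otimes> w = \<zero>" "w \<in> ?K \<or> w \<in> ?L"
    proof (cases "y \<otimes> x = \<zero>")
      case True
      then show thesis using that[of y] y by blast
    next
      case False
      have "i \<otimes> (y \<otimes> x) = \<zero>" if "i \<in> I" for i
        using that y x ideal.Icarr[OF I that] m_assoc[of i y x] by simp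
      then show thesis using that[of "y \<otimes> x"] False x y z xz by (simp add: m_assoc)
    qed
    have "PIdl w \<subseteq> ?K \<or> PIdl w \<subseteq> ?L"
      using w(4) cgenideal_minimal[OF ideal_annihilator] x z by blast
    moreover have "PIdl w \<noteq> {\<zero>}" using w cgenideal_self by blast
    ultimately have "PIdl w \<in> ?P" using cgenideal_ideal[OF w(1)] by blast
    moreover have "I \<cdot> (PIdl w) = {\<zero>}" using w I by (simp add: ideal_prod_cgenideal_eq_zero_iff)
    ultimately show ?thesis using I by blast
  qed simp
  then have "{I. ideal I R} \<subseteq> insert (carrier R) (\<Union>J\<in>?P. {I. ideal I R \<and> I \<cdot> J = {\<zero>}})"
    by blast
  moreover have "finite \<dots>"
    using finK finL finite_annihilated_ideals[OF deg] by auto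
  ultimately show ?thesis by (rule finite_subset)
qed

section \<open>Fields, the zero ring, and graphs with a vertex\<close>

lemma finite_ideals_field:
  assumes "field R"
  shows "finite {I. ideal I R}"
  using field.all_ideals[OF assms] by simp

lemma finite_degree_if_finite_ugraph: "finite_ugraph G \<Longrightarrow> finite_degree G v"
  by (simp add: finite_ugraph_def finite_degree_def neighbours_def)

text \<open>A vertex \<open>I\<close> yields the zero divisors: \<open>x\<close> is taken from
  \<open>I\<close> and \<open>z\<close> from its annihilator.\<close>

lemma finite_ideals_if_finite_degrees_nonempty:
  assumes deg: "\<forall>I \<in> vertices (annihilating_ideal_graph R).
      finite_degree (annihilating_ideal_graph R) I"
    and "vertices (annihilating_ideal_graph R) \<noteq> {}"
  shows "finite {I. ideal I R}"
proof -
  obtain I where I: "ideal I R" "I \<noteq> {\<zero>}" "I \<in> annihilating_ideals R"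
    using assms(2) annihilating_ideals_iff unfolding vertices_annihilating_ideal_graph by blast
  obtain z where z: "z \<in> carrier R" "z \<noteq> \<zero>" "\<And>i. i \<in> I \<Longrightarrow> i \<otimes> z = \<zero>"
    using I(3) by (auto simp: annihilating_ideals_iff)
  obtain x where x: "x \<in> I" "x \<noteq> \<zero>" using I(2) ideal_neq_zero_iff[OF I(1)] by blast
  show ?thesis
    using finite_ideals_of_finite_degrees[OF deg _ x(2) z(1,2) z(3)[OF x(1)]]
      ideal.Icarr[OF I(1) x(1)] .
qed

text \<open>Without zero divisors the degree condition is vacuous, and finiteness comes from
  \<open>dom\<close>. The zero ring is treated apart because \<open>domain\<close> demands
  \<open>1\<close> distinct from \<open>0\<close>.\<close>

lemma finite_ideals_if_finite_degrees:
  assumes deg: "\<forall>I \<in> vertices (annihilating_ideal_graph R).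
      finite_degree (annihilating_ideal_graph R) I"
    and dom: "domain R \<longrightarrow> field R"
  shows "finite {I. ideal I R}"
proof (cases "\<exists>x\<in>carrier R. \<exists>z\<in>carrier R. x \<noteq> \<zero> \<and> z \<noteq> \<zero> \<and> x \<otimes> z = \<zero>")
  case True
  then show ?thesis using finite_ideals_of_finite_degrees[OF deg] by blast
next
  case no_zero_divisors: False
  show ?thesis
  proof (cases "\<one> = \<zero>")
    case True
    then have "carrier R = {\<zero>}" by (rule one_zeroD)
    then have "{I. ideal I R} \<subseteq> Pow {\<zero>}" using ideal.Icarr by fastforce
    then show ?thesis by (rule finite_subset) simp
  next
    case False
    then have "domain R" using no_zero_divisors by unfold_locales auto
    then show ?thesis using dom finite_ideals_field by blast
  qed
qed

end

text \<open>The condition \<open>domain R \<longrightarrow> field R\<close> excludes rings such as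
  the integers: their graph is empty, so finiteness of the graph and of all degrees holds trivially,
  yet there are infinitely many ideals.\<close>

theorem theorem1p4:
  fixes R :: "('a, 'b) ring_scheme"
  assumes "cring R"
  shows "((domain R \<longrightarrow> field R) \<longrightarrow>
            (finite_ugraph (annihilating_ideal_graph R) \<longleftrightarrow> finite {I. ideal I R}) \<and>
            (finite {I. ideal I R} \<longleftrightarrow>
              (\<forall>I \<in> vertices (annihilating_ideal_graph R).
                 finite_degree (annihilating_ideal_graph R) I)))
       \<and> (\<forall>n::nat. n \<ge> 1 \<longrightarrow>
            (finite_ugraph (annihilating_ideal_graph R) \<and>
               card (vertices (annihilating_ideal_graph R)) = n
             \<longleftrightarrow> finite (nonzero_proper_ideals R) \<and> card (nonzero_proper_ideals R) = n))"
proof -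
  interpret cring R by (rule assms)
  let ?G = "annihilating_ideal_graph R"
  have fin_graph: "finite_ugraph ?G" if "finite {I. ideal I R}"
    using that vertices_eq_nonzero_proper_ideals finite_nonzero_proper_ideals_iff
    by (simp add: finite_ugraph_def)
  show ?thesis
  proof (intro conjI impI allI)
    assume dom: "domain R \<longrightarrow> field R"
    show "finite_ugraph ?G \<longleftrightarrow> finite {I. ideal I R}"
      using finite_ideals_if_finite_degrees[OF _ dom] fin_graph
        finite_degree_if_finite_ugraph[of ?G] by blast
    show "finite {I. ideal I R} \<longleftrightarrow> (\<forall>I \<in> vertices ?G. finite_degree ?G I)"
      using finite_ideals_if_finite_degrees[OF _ dom] fin_graph
        finite_degree_if_finite_ugraph[of ?G] by blast
  next
    fix n :: nat assume n: "n \<ge> 1"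
    \<comment> \<open>Since \<open>n\<close> is at least 1, the graph has a vertex, which supplies
      zero divisors.\<close>
    have "finite {I. ideal I R}" if "finite_ugraph ?G" "card (vertices ?G) = n"
      using that n finite_ideals_if_finite_degrees_nonempty
        finite_degree_if_finite_ugraph[of ?G] by fastforce
    then show "finite_ugraph ?G \<and> card (vertices ?G) = n \<longleftrightarrow>
        finite (nonzero_proper_ideals R) \<and> card (nonzero_proper_ideals R) = n"
      using vertices_eq_nonzero_proper_ideals finite_nonzero_proper_ideals_iff fin_graph
      by metis
  qed
qed

end
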